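(* Let $G=(V,E)$ be a graph, let $t\ge 2$ be even, and let $G_t$ be the $t$-subdivision of $G$. Let $I$ and $J$ be two maximum independent sets of $G$, and let $I'$ and $J'$ be extensions of $I$ and $J$ in $G_t$, respectively. Let $R\in\{\mathrm{TS},\mathrm{TJ}\}$. Then there is an $R$-reconfiguration sequence from $I$ to $J$ in $G$ if and only if there is an $R$-reconfiguration sequence from $I'$ to $J'$ in $G_t$.
   Context: The $t$-subdivision $G_t$ of $G$ is obtained by replacing each edge $uv$ of $G$ by a path $u,s^1_{uv},\dots,s^t_{uv},v$ with $t$ new internal vertices; we identify $V$ with the corresponding subset of $V(G_t)$. For an independent set $I$ of $G$, an extension of $I$ in $G_t$ is an independent set $I'$ of $G_t$ obtained from $I$ by adding, for each edge $uv$ of $G$, exactly $t/2$ of the internal vertices $s^1_{uv},\dots,s^t_{uv}$ (so $I'\cap V=I$). Two independent sets $A,B$ are TJ-adjacent if $|A\setminus B|=|B\setminus A|=1$, and TS-adjacent if moreover the unique vertex of $A\setminus B$ and the unique vertex of $B\setminus A$ are adjacent. An $R$-reconfiguration sequence from $A$ to $B$ is a sequence $A=A_0,\dots,A_\ell=B$ of independent sets with consecutive sets $R$-adjacent. *)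

theory Defs
  imports "Graph_Theory.Pair_Digraph"
begin

text \<open>A finite simple graph is a \<^locale>\<open>pair_graph\<close>: finite, symmetric and loop-free,
  so an undirected edge \<open>uv\<close> is present as the two arcs \<open>(u, v)\<close> and \<open>(v, u)\<close>.\<close>

text \<open>The internal vertex \<open>s\<^sup>i\<^sub>u\<^sub>v\<close> is \<open>Inner {(u, i), (v, t + 1 - i)}\<close>, which records its
  distances along the path to the two ends. Hence \<open>s\<^sup>i\<^sub>u\<^sub>v\<close> and \<open>s\<^bsup>t+1-i\<^esup>\<^sub>v\<^sub>u\<close> are the same
  vertex and no orientation of the edges has to be chosen.\<close>

datatype 'a svertex = Orig 'a | Inner "('a \<times> nat) set"

definition inner_vertex :: "nat \<Rightarrow> 'a \<Rightarrow> 'a \<Rightarrow> nat \<Rightarrow> 'a svertex" where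
  "inner_vertex t u v i = Inner {(u, i), (v, t + 1 - i)}"

definition inner_vertices :: "nat \<Rightarrow> 'a \<Rightarrow> 'a \<Rightarrow> 'a svertex set" where
  "inner_vertices t u v = inner_vertex t u v ` {1..t}"

definition subdiv_path :: "nat \<Rightarrow> 'a \<Rightarrow> 'a \<Rightarrow> 'a svertex list" where
  "subdiv_path t u v = Orig u # map (inner_vertex t u v) [1..<t + 1] @ [Orig v]"

text \<open>Each edge contributes its path once in each direction, which makes the arc set symmetric.\<close>

definition t_subdivision :: "nat \<Rightarrow> 'a pair_pre_digraph \<Rightarrow> 'a svertex pair_pre_digraph" where
  "t_subdivision t G =
    \<lparr> pverts = Orig ` pverts G \<union> (\<Union>(u, v)\<in>parcs G. inner_vertices t u v),
      parcs = (\<Union>(u, v)\<in>parcs G.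
        {(subdiv_path t u v ! i, subdiv_path t u v ! Suc i) | i. i \<le> t}) \<rparr>"

definition independent_set :: "'a pair_pre_digraph \<Rightarrow> 'a set \<Rightarrow> bool" where
  "independent_set G S \<longleftrightarrow> S \<subseteq> pverts G \<and> (\<forall>u\<in>S. \<forall>v\<in>S. (u, v) \<notin> parcs G)"

definition maximum_independent_set :: "'a pair_pre_digraph \<Rightarrow> 'a set \<Rightarrow> bool" where
  "maximum_independent_set G S \<longleftrightarrow>
    independent_set G S \<and> (\<forall>T. independent_set G T \<longrightarrow> card T \<le> card S)"

definition extension :: "nat \<Rightarrow> 'a pair_pre_digraph \<Rightarrow> 'a set \<Rightarrow> 'a svertex set \<Rightarrow> bool" where
  "extension t G S S' \<longleftrightarrow>
    independent_set (t_subdivision t G) S' \<and>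
    S' \<inter> Orig ` pverts G = Orig ` S \<and>
    (\<forall>(u, v)\<in>parcs G. card (S' \<inter> inner_vertices t u v) = t div 2)"

datatype rule = TS | TJ

fun adjacent :: "rule \<Rightarrow> 'a pair_pre_digraph \<Rightarrow> 'a set \<Rightarrow> 'a set \<Rightarrow> bool" where
  "adjacent TJ G A B \<longleftrightarrow> card (A - B) = 1 \<and> card (B - A) = 1"
| "adjacent TS G A B \<longleftrightarrow> (\<exists>u v. A - B = {u} \<and> B - A = {v} \<and> (u, v) \<in> parcs G)"

definition reconf_sequence ::
    "rule \<Rightarrow> 'a pair_pre_digraph \<Rightarrow> 'a set \<Rightarrow> 'a set \<Rightarrow> 'a set list \<Rightarrow> bool" where
  "reconf_sequence R G A B Ss \<longleftrightarrow>
    Ss \<noteq> [] \<and> hd Ss = A \<and> last Ss = B \<and>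
    (\<forall>S\<in>set Ss. independent_set G S) \<and> successively (adjacent R G) Ss"

lemma inner_vertex_swap:
  "1 \<le> i \<Longrightarrow> i \<le> t \<Longrightarrow> inner_vertex t v u (t + 1 - i) = inner_vertex t u v i"
  by (auto simp: inner_vertex_def)

lemma inner_vertex_eq_iff:
  assumes "u \<noteq> v" "u' \<noteq> v'" "i \<in> {1..t}" "j \<in> {1..t}"
  shows "inner_vertex t u v i = inner_vertex t u' v' j \<longleftrightarrow>
    (u = u' \<and> v = v' \<and> i = j) \<or> (u = v' \<and> v = u' \<and> i + j = t + 1)"
  using assms by (auto simp: inner_vertex_def doubleton_eq_iff)

lemma subdiv_path_nth:
  "i \<le> Suc t \<Longrightarrow> subdiv_path t u v ! i =
    (if i = 0 then Orig u else if i = Suc t then Orig v else inner_vertex t u v i)"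
  by (auto simp: subdiv_path_def nth_Cons nth_append split: nat.splits simp del: upt_Suc)

lemma subdiv_path_swap:
  "i \<le> Suc t \<Longrightarrow> subdiv_path t v u ! (Suc t - i) = subdiv_path t u v ! i"
  using inner_vertex_swap[of i t v u] by (auto simp: subdiv_path_nth)

lemma pair_graph_t_subdivision:
  assumes "pair_graph G"
  shows "pair_graph (t_subdivision t G)"
proof -
  interpret pair_graph G by fact
  have loop: "u \<noteq> v" if "(u, v) \<in> parcs G" for u v
    using that no_loops' by blast
  have inv: "subdiv_path t u v ! i \<in> pverts (t_subdivision t G)"
    if "(u, v) \<in> parcs G" "i \<le> Suc t" for u v i
    using that in_arcsD1[OF that(1)] in_arcsD2[OF that(1)]
    by (force simp: subdiv_path_nth t_subdivision_def inner_vertices_def)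
  show ?thesis
  proof
    fix e assume "e \<in> parcs (t_subdivision t G)"
    then obtain u v i where e: "(u, v) \<in> parcs G" "i \<le> t"
        "e = (subdiv_path t u v ! i, subdiv_path t u v ! Suc i)"
      by (auto simp: t_subdivision_def)
    show "fst e \<in> pverts (t_subdivision t G)" "snd e \<in> pverts (t_subdivision t G)"
      using e inv by auto
    show "fst e \<noteq> snd e"
      using e loop[OF e(1)] inner_vertex_eq_iff[of u v u v i t "Suc i"]
      by (auto simp: subdiv_path_nth inner_vertex_def)
  next
    show "finite (pverts (t_subdivision t G))"
      by (auto simp: t_subdivision_def inner_vertices_def)
    have "{(subdiv_path t u v ! i, subdiv_path t u v ! Suc i) | i. i \<le> t} =
       (\<lambda>i. (subdiv_path t u v ! i, subdiv_path t u v ! Suc i)) ` {..t}" for u v :: 'a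
      by auto
    then show "finite (parcs (t_subdivision t G))"
      by (auto simp: t_subdivision_def)
  next
    have "(y, x) \<in> parcs (t_subdivision t G)" if xy: "(x, y) \<in> parcs (t_subdivision t G)" for x y
    proof -
      obtain u v i where e: "(u, v) \<in> parcs G" "i \<le> t"
          "x = subdiv_path t u v ! i" "y = subdiv_path t u v ! Suc i"
        using xy by (auto simp: t_subdivision_def)
      have "(v, u) \<in> parcs G"
        using e(1) arcs_symmetric by blast
      moreover have "y = subdiv_path t v u ! (t - i)" "x = subdiv_path t v u ! Suc (t - i)"
        using e subdiv_path_swap[of i t v u] subdiv_path_swap[of "Suc i" t v u]
        by (auto simp: Suc_diff_le)
      ultimately show ?thesis
        by (auto simp: t_subdivision_def intro!: bexI[of _ "(v, u)"] exI[of _ "t - i"])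
    qed
    then show "symmetric (with_proj (t_subdivision t G))"
      by (auto simp: symmetric_def intro!: symI)
  qed
qed

end

theory Submission
  imports Defs
begin

text \<open>
  Between maximum independent sets every token jump is a slide, so only \<^const>\<open>TS\<close> matters.
  If \<open>S\<close> is independent in \<open>G\<^sub>t\<close>, each subdivided edge carries at most \<open>t/2\<close> inner tokens, and
  fewer (it is deficient) when both its ends are in \<open>S\<close>. Given an inclusion-maximal independent
  subset \<open>A\<close> of \<open>S \<inter> V\<close>, every vertex of \<open>(S \<inter> V) - A\<close> has a neighbour in \<open>A\<close> and so yields its
  own deficient edge; hence \<open>|S| \<le> \<alpha>(G) + |E| t/2\<close> and extensions of maximum sets are maximum.

  From \<open>G\<^sub>t\<close> to \<open>G\<close>: along a sequence of slides one maintains a maximum independent set \<open>A\<close> of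
  \<open>G\<close> with \<open>A \<subseteq> S\<close>. If a token leaves \<open>u \<in> A\<close> towards \<open>v\<close>, the edge \<open>uv\<close> was deficient, and equality
  in the counting forces \<open>v \<in> S\<close> with \<open>u\<close> its only neighbour in \<open>A\<close>, so \<open>A\<close> follows by sliding
  \<open>u\<close> to \<open>v\<close>.

  From \<open>G\<close> to \<open>G\<^sub>t\<close>: extensions of equal or \<^const>\<open>TS\<close>-adjacent sets differ only in inner vertices
  and in the two ends of one edge, which induce a forest; sliding towards a leaf of the symmetric
  difference repeatedly turns one into the other.
\<close>

section \<open>Reconfiguration of maximum independent sets\<close>

definition reconf_step :: "rule \<Rightarrow> 'a pair_pre_digraph \<Rightarrow> 'a set \<Rightarrow> 'a set \<Rightarrow> bool" where
  "reconf_step R G A B \<longleftrightarrow> independent_set G A \<and> independent_set G B \<and> adjacent R G A B"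

section \<open>Sequences as chains of single steps\<close>

lemma reconf_steps_if_reconf_sequence:
  assumes "reconf_sequence R G A B Ss"
  shows "independent_set G A \<and> (reconf_step R G)\<^sup>*\<^sup>* A B"
  using assms
proof (induction Ss arbitrary: A)
  case Nil
  then show ?case by (simp add: reconf_sequence_def)
next
  case (Cons S Ss)
  show ?case
  proof (cases Ss)
    case Nil
    then show ?thesis using Cons.prems by (auto simp: reconf_sequence_def)
  next
    case (Cons S' Ss')
    then have "reconf_sequence R G S' B Ss" "reconf_step R G A S'"
      using Cons.prems by (auto simp: reconf_sequence_def reconf_step_def)
    then show ?thesis
      using Cons.IH by (auto simp: reconf_step_def intro: converse_rtranclp_into_rtranclp)
  qed
qed

lemma ex_reconf_sequence_if_reconf_steps:
  assumes "(reconf_step R G)\<^sup>*\<^sup>* A B" "independent_set G A"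
  shows "\<exists>Ss. reconf_sequence R G A B Ss"
  using assms
proof (induction rule: converse_rtranclp_induct)
  case base
  then have "reconf_sequence R G B B [B]" by (simp add: reconf_sequence_def)
  then show ?case ..
next
  case (step S S')
  then obtain Ss where "reconf_sequence R G S' B Ss"
    by (auto simp: reconf_step_def)
  then have "reconf_sequence R G S B (S # Ss)"
    using step.hyps(1) by (cases Ss) (auto simp: reconf_sequence_def reconf_step_def)
  then show ?case ..
qed

text \<open>The conjunct \<open>independent_set G A\<close> matters for the empty chain only, as
  each \<open>reconf_step\<close> asserts independence of both its sets.\<close>

lemma ex_reconf_sequence_iff:
  "(\<exists>Ss. reconf_sequence R G A B Ss) \<longleftrightarrow>
    independent_set G A \<and> (reconf_step R G)\<^sup>*\<^sup>* A B"
  using reconf_steps_if_reconf_sequence ex_reconf_sequence_if_reconf_steps by metis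

lemma maximum_independent_setD: "maximum_independent_set G A \<Longrightarrow> independent_set G A"
  by (simp add: maximum_independent_set_def)

lemma maximum_independent_set_if_card_ge:
  assumes "maximum_independent_set G A" "independent_set G B" "card A \<le> card B"
  shows "maximum_independent_set G B"
  using assms by (fastforce simp: maximum_independent_set_def)

lemma adjacent_imp_jumping: "adjacent R G A B \<Longrightarrow> adjacent TJ G A B"
  by (cases R) (simp_all, elim exE conjE, simp)

context pair_graph
begin

lemma finite_independent_set: "independent_set G A \<Longrightarrow> finite A"
  using finite_subset[of A "pverts G"] by (auto simp: independent_set_def)

lemma arc_sym: "(u, v) \<in> parcs G \<Longrightarrow> (v, u) \<in> parcs G"
  using arcs_symmetric by blast

lemma arc_neq: "(u, v) \<in> parcs G \<Longrightarrow> u \<noteq> v"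
  using no_loops' by blast

lemma independent_set_insert:
  assumes "independent_set G A" "b \<in> pverts G" "\<And>a. a \<in> A \<Longrightarrow> (b, a) \<notin> parcs G"
  shows "independent_set G (insert b A)"
  using assms arc_sym arc_neq unfolding independent_set_def by blast

text \<open>Without such a neighbour, \<open>insert b A\<close> would be a larger independent
  set.\<close>

lemma maximum_independent_set_dominates:
  assumes "maximum_independent_set G A" "b \<in> pverts G" "b \<notin> A"
  shows "\<exists>a\<in>A. (b, a) \<in> parcs G"
proof -
  have "\<not> card (insert b A) \<le> card A"
    using assms finite_independent_set[of A] by (simp add: maximum_independent_set_def)
  then have "\<not> independent_set G (insert b A)"
    using assms by (auto simp: maximum_independent_set_def)
  then show ?thesis
    using independent_set_insert[of A b] assms by (auto simp: maximum_independent_set_def)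
qed

section \<open>Steps between maximum independent sets: constant size, jumps as slides\<close>

lemma reconf_step_card_eq:
  assumes "reconf_step R G A B"
  shows "card A = card B"
proof -
  have fin: "finite A" "finite B"
    using assms finite_independent_set by (auto simp: reconf_step_def)
  have "card (A - B) = card (B - A)"
    using assms adjacent_imp_jumping[of R G A B] by (simp add: reconf_step_def)
  then have "card (A \<inter> B) + card (A - B) = card (A \<inter> B) + card (B - A)"
    by simp
  then show ?thesis
    using card_Int_Diff[OF fin(1), of B] card_Int_Diff[OF fin(2), of A] by (simp add: Int_commute)
qed

lemma reconf_step_maximum:
  assumes "maximum_independent_set G A" "reconf_step R G A B"
  shows "maximum_independent_set G B"
  using assms reconf_step_card_eq[OF assms(2)] maximum_independent_set_if_card_ge[of G A B]
  by (simp add: reconf_step_def)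

text \<open>The vertex \<open>v\<close> that enters has a neighbour in \<open>A\<close> by
  domination; this neighbour cannot stay in \<open>B\<close> next to \<open>v\<close>, so it is the
  vertex that leaves.\<close>

lemma reconf_step_sliding_iff:
  assumes max: "maximum_independent_set G A"
  shows "reconf_step R G A B \<longleftrightarrow> reconf_step TS G A B"
proof (cases R)
  case TJ
  have "adjacent TS G A B" if step: "reconf_step TJ G A B"
  proof -
    obtain u v where uv: "A - B = {u}" "B - A = {v}"
      using step by (auto simp: reconf_step_def card_1_singleton_iff)
    then have v: "v \<in> B" "v \<notin> A" by blast+
    have B: "independent_set G B"
      using step by (simp add: reconf_step_def)
    then have "v \<in> pverts G" using v by (auto simp: independent_set_def)
    then obtain a where a: "a \<in> A" "(v, a) \<in> parcs G"
      using maximum_independent_set_dominates[OF max] v by blast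
    then have "a \<notin> B"
      using B v by (auto simp: independent_set_def)
    then have "a = u" using uv a by blast
    then show ?thesis using uv a arc_sym by auto
  qed
  then show ?thesis
    unfolding TJ using adjacent_imp_jumping[of TS G A B] by (meson reconf_step_def)
qed simp

lemma reconf_steps_sliding_iff:
  assumes "maximum_independent_set G A"
  shows "(reconf_step R G)\<^sup>*\<^sup>* A B \<longleftrightarrow> (reconf_step TS G)\<^sup>*\<^sup>* A B"
proof -
  \<comment> \<open>Two arbitrary rules, so that one induction serves both directions. Maximality is
    carried along because each step is translated at its own starting set.\<close>
  have "(reconf_step R' G)\<^sup>*\<^sup>* A B \<Longrightarrow> maximum_independent_set G B \<and> (reconf_step R'' G)\<^sup>*\<^sup>* A B"
    for R' R''
  proof (induction rule: rtranclp_induct)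
    case base
    then show ?case using assms by simp
  next
    case (step S T)
    then have "reconf_step R'' G S T"
      using reconf_step_sliding_iff by blast
    then show ?case
      using step reconf_step_maximum by (metis rtranclp.rtrancl_into_rtrancl)
  qed
  then show ?thesis by blast
qed

text \<open>Domination gives \<open>x\<close> a neighbour in \<open>S\<close>; it is not in
  \<open>T\<close>, which is independent and contains \<open>x\<close>, so it must be
  \<open>y\<close>. Hence \<open>x\<close> has no other neighbour in \<open>S\<close> and may
  replace \<open>y\<close>. The reverse step serves for slides made at the target end of a
  chain.\<close>

lemma slide_towards:
  assumes S: "maximum_independent_set G S" and T: "independent_set G T" and x: "x \<in> T - S"
    and nb: "\<And>z. z \<in> S - T \<Longrightarrow> (x, z) \<in> parcs G \<Longrightarrow> z = y"
  shows "y \<in> S - T" "maximum_independent_set G (insert x (S - {y}))"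
    "reconf_step TS G S (insert x (S - {y}))" "reconf_step TS G (insert x (S - {y})) S"
proof -
  have xG: "x \<in> pverts G"
    using x T by (auto simp: independent_set_def)
  have nbS: "z = y \<and> z \<in> S - T" if "z \<in> S" "(x, z) \<in> parcs G" for z
    using that nb x T unfolding independent_set_def by blast
  obtain z where "z \<in> S" "(x, z) \<in> parcs G"
    using maximum_independent_set_dominates[OF S xG] x by blast
  then have y: "y \<in> S - T" "(x, y) \<in> parcs G"
    using nbS by blast+
  then show "y \<in> S - T" by simp
  have "independent_set G (S - {y})"
    using maximum_independent_setD[OF S] by (auto simp: independent_set_def)
  then have ind: "independent_set G (insert x (S - {y}))"
    using independent_set_insert xG nbS by blast
  have diff: "S - insert x (S - {y}) = {y}" "insert x (S - {y}) - S = {x}"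
    using x y by auto
  then show "reconf_step TS G S (insert x (S - {y}))" "reconf_step TS G (insert x (S - {y})) S"
    using ind maximum_independent_setD[OF S] y arc_sym by (auto simp: reconf_step_def)
  then show "maximum_independent_set G (insert x (S - {y}))"
    using reconf_step_maximum S by blast
qed

text \<open>The hypothesis on \<open>Y\<close> says that the symmetric difference induces a forest. By maximality, a
  vertex of the symmetric difference with at most one neighbour in it has exactly one, and a token
  can slide along the edge between them.\<close>

lemma reconf_steps_if_forest:
  assumes "maximum_independent_set G S" "maximum_independent_set G T"
    and "\<And>Y. Y \<subseteq> (S - T) \<union> (T - S) \<Longrightarrow> Y \<noteq> {} \<Longrightarrow>
      \<exists>x\<in>Y. \<exists>y. \<forall>z\<in>Y. (x, z) \<in> parcs G \<longrightarrow> z = y"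
  shows "(reconf_step TS G)\<^sup>*\<^sup>* S T"
  using assms
proof (induction "card (S - T)" arbitrary: S T rule: less_induct)
  case less
  have fin: "finite S" "finite T"
    using less.prems maximum_independent_setD finite_independent_set by blast+
  show ?case
  proof (cases "S = T")
    case False
    obtain x y where x: "x \<in> (S - T) \<union> (T - S)"
      and xy: "\<And>z. z \<in> (S - T) \<union> (T - S) \<Longrightarrow> (x, z) \<in> parcs G \<Longrightarrow> z = y"
      using less.prems(3)[of "(S - T) \<union> (T - S)"] False by blast
    show ?thesis
    proof (cases "x \<in> T")
      case True
      let ?S = "insert x (S - {y})"
      have *: "y \<in> S - T" "maximum_independent_set G ?S" "reconf_step TS G S ?S"
        using slide_towards[of S T x y] less.prems True x xy maximum_independent_setD by blast+
      have "?S - T = S - T - {y}" using True by auto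
      then have "card (?S - T) < card (S - T)"
        using * fin by (metis card_Diff1_less finite_Diff)
      \<comment> \<open>The symmetric difference only shrinks, so the forest hypothesis is
        inherited.\<close>
      moreover have "(?S - T) \<union> (T - ?S) \<subseteq> (S - T) \<union> (T - S)"
        using True * by auto
      ultimately have "(reconf_step TS G)\<^sup>*\<^sup>* ?S T"
        using less.hyps[of ?S T] * less.prems by (meson order_trans)
      then show ?thesis
        using * by (meson converse_rtranclp_into_rtranclp)
    next
      case False
      \<comment> \<open>Now \<open>x\<close> lies in \<open>S - T\<close>: the slide is made in
        \<open>T\<close>, and its reverse becomes the last step of the chain.\<close>
      let ?T = "insert x (T - {y})"
      have *: "y \<in> T - S" "maximum_independent_set G ?T" "reconf_step TS G ?T T"
        using slide_towards[of T S x y] less.prems False x xy maximum_independent_setD by blast+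
      have "S - ?T = S - T - {x}" using False * by auto
      then have "card (S - ?T) < card (S - T)"
        using False x fin by (metis DiffI UnE card_Diff1_less finite_Diff DiffD1)
      moreover have "(S - ?T) \<union> (?T - S) \<subseteq> (S - T) \<union> (T - S)"
        using False x * by auto
      ultimately have "(reconf_step TS G)\<^sup>*\<^sup>* S ?T"
        using less.hyps[of S ?T] * less.prems by (meson order_trans)
      then show ?thesis
        using * by (meson rtranclp.rtrancl_into_rtrancl)
    qed
  qed simp
qed

end

section \<open>The subdivision\<close>

locale even_subdivision = pair_graph G for G :: "'a pair_pre_digraph" +
  fixes t :: nat
  assumes even_t: "even t" and t_ge_2: "t \<ge> 2"
begin

abbreviation "Gt \<equiv> t_subdivision t G"

abbreviation path_vertex :: "'a \<Rightarrow> 'a \<Rightarrow> nat \<Rightarrow> 'a svertex" where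
  "path_vertex u v i \<equiv> subdiv_path t u v ! i"

text \<open>Collecting sets of vertices identifies the two arcs of an edge, so
  \<open>card inner_paths\<close> is the number of edges of \<open>G\<close>.\<close>

definition inner_paths :: "'a svertex set set" where
  "inner_paths = (\<lambda>(u, v). inner_vertices t u v) ` parcs G"

sublocale Gt: pair_graph Gt
  using pair_graph_t_subdivision pair_graph_axioms by blast

section \<open>Vertices and arcs on the subdivided edges\<close>

lemma inner_vertices_swap: "inner_vertices t v u = inner_vertices t u (v :: 'a)"
proof -
  have "inner_vertices t v u \<subseteq> inner_vertices t u v" for u v :: 'a
  proof
    fix x assume "x \<in> inner_vertices t v u"
    then obtain i where "i \<in> {1..t}" "x = inner_vertex t v u i"
      by (auto simp: inner_vertices_def)
    then show "x \<in> inner_vertices t u v"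
      using inner_vertex_swap[of i t u v]
      by (auto simp: inner_vertices_def intro!: image_eqI[of _ _ "t + 1 - i"])
  qed
  then show ?thesis by (intro equalityI)
qed

lemma inner_vertices_Int:
  assumes "(u, v) \<in> parcs G" "(u', v') \<in> parcs G"
    and "x \<in> inner_vertices t u v" "x \<in> inner_vertices t u' v'"
  shows "(u' = u \<and> v' = v) \<or> (u' = v \<and> v' = u)"
  using assms arc_neq[OF assms(1)] arc_neq[OF assms(2)]
  by (auto simp: inner_vertices_def inner_vertex_eq_iff)

lemma inner_vertices_eqD:
  assumes "(u, v) \<in> parcs G" "(u', v') \<in> parcs G" "inner_vertices t u v = inner_vertices t u' v'"
  shows "(u' = u \<and> v' = v) \<or> (u' = v \<and> v' = u)"
proof -
  have "inner_vertex t u v 1 \<in> inner_vertices t u v"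
    using t_ge_2 by (auto simp: inner_vertices_def)
  then show ?thesis using inner_vertices_Int assms by metis
qed

lemma finite_inner_paths [simp]: "finite inner_paths"
  by (simp add: inner_paths_def)

lemma finite_inner_vertices [simp]: "finite (inner_vertices t u v)"
  by (simp add: inner_vertices_def)

lemma Orig_notin_inner_vertices [simp]: "Orig w \<notin> inner_vertices t u v"
  by (auto simp: inner_vertices_def inner_vertex_def)

lemma Orig_in_pverts_iff [simp]: "Orig u \<in> pverts Gt \<longleftrightarrow> u \<in> pverts G"
  by (auto simp: t_subdivision_def)

lemma pverts_Gt: "pverts Gt = Orig ` pverts G \<union> \<Union>inner_paths"
  by (auto simp: t_subdivision_def inner_paths_def)

lemma path_vertex_arc:
  "(u, v) \<in> parcs G \<Longrightarrow> i \<le> t \<Longrightarrow> (path_vertex u v i, path_vertex u v (Suc i)) \<in> parcs Gt"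
  by (auto simp: t_subdivision_def)

lemma arc_Gt_cases:
  assumes "(x, y) \<in> parcs Gt"
  obtains u v i where "(u, v) \<in> parcs G" "i \<le> t" "x = path_vertex u v i"
    "y = path_vertex u v (Suc i)"
  using assms by (auto simp: t_subdivision_def)

lemma path_vertex_inner:
  "1 \<le> i \<Longrightarrow> i \<le> t \<Longrightarrow> path_vertex u v i = inner_vertex t u v i"
  by (simp add: subdiv_path_nth)

lemma path_vertex_inj:
  assumes "(u, v) \<in> parcs G" "1 \<le> i" "i \<le> t" "1 \<le> j" "j \<le> t"
    and "path_vertex u v i = path_vertex u v j"
  shows "i = j"
  using assms inner_vertex_eq_iff[of u v u v i t j] arc_neq[OF assms(1)]
  by (simp add: path_vertex_inner)

lemma path_vertex_in_inner_vertices: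
  "1 \<le> i \<Longrightarrow> i \<le> t \<Longrightarrow> path_vertex u v i \<in> inner_vertices t u v"
  by (auto simp: path_vertex_inner inner_vertices_def)

lemma inner_verticesE:
  assumes "x \<in> inner_vertices t u v"
  obtains i where "1 \<le> i" "i \<le> t" "x = path_vertex u v i"
  using assms by (auto simp: inner_vertices_def path_vertex_inner)

lemma path_vertex_ends [simp]: "path_vertex u v 0 = Orig u" "path_vertex u v (Suc t) = Orig v"
  by (simp_all add: subdiv_path_nth)

lemma arc_from_inner:
  assumes uv: "(u, v) \<in> parcs G" and i: "1 \<le> i" "i \<le> t"
    and arc: "(path_vertex u v i, y) \<in> parcs Gt"
  shows "y = path_vertex u v (i - 1) \<or> y = path_vertex u v (Suc i)"
proof -
  obtain u' v' j where j: "(u', v') \<in> parcs G" "j \<le> t"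
      "path_vertex u v i = path_vertex u' v' j" "y = path_vertex u' v' (Suc j)"
    using arc by (rule arc_Gt_cases)
  have "1 \<le> j"
    using j i by (cases j) (auto simp: path_vertex_inner inner_vertex_def)
  then have "(u = u' \<and> v = v' \<and> i = j) \<or> (u = v' \<and> v = u' \<and> i + j = t + 1)"
    using j i inner_vertex_eq_iff[of u v u' v' i t j] arc_neq[OF uv] arc_neq[OF j(1)]
    by (simp add: path_vertex_inner)
  then show ?thesis
  proof
    \<comment> \<open>The arc comes from the same path walked from \<open>v\<close>: position
      \<open>j\<close> there is \<open>i\<close> here, so its successor is \<open>i - 1\<close>
      here.\<close>
    assume *: "u = v' \<and> v = u' \<and> i + j = t + 1"
    then have "Suc t - (i - 1) = Suc j" using i by auto
    then show ?thesis using * j(4) i subdiv_path_swap[of "i - 1" t v u] by auto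
  qed (use j in auto)
qed

lemma arc_from_Orig:
  assumes "(Orig u, y) \<in> parcs Gt"
  obtains w where "(u, w) \<in> parcs G" "y = path_vertex u w 1"
proof -
  obtain u' v' j where j: "(u', v') \<in> parcs G" "j \<le> t"
      "Orig u = path_vertex u' v' j" "y = path_vertex u' v' (Suc j)"
    using assms by (rule arc_Gt_cases)
  then have "j = 0" "u' = u"
    by (cases j; auto simp: path_vertex_inner inner_vertex_def)+
  then show ?thesis using j that by simp
qed

lemma arc_Orig_Orig: "(Orig u, Orig v) \<notin> parcs Gt"
proof
  assume "(Orig u, Orig v) \<in> parcs Gt"
  then obtain w where "Orig v = path_vertex u w 1" by (rule arc_from_Orig)
  then show False using t_ge_2 by (simp add: path_vertex_inner inner_vertex_def)
qed

text \<open>Every edge other than \<open>uv\<close> has an end outside \<open>{u, v}\<close>, so its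
  path is attached to that of \<open>uv\<close> at one end at most, and no cycle arises. A leaf is
  found as the first vertex of \<open>Y\<close> on a path walked from a suitable end.\<close>

lemma leaf_of_inner_with_edge:
  assumes uv: "(u, v) \<in> parcs G"
    and Y: "Y \<subseteq> \<Union>inner_paths \<union> {Orig u, Orig v}" "Y \<noteq> {}"
  shows "\<exists>x\<in>Y. \<exists>y. \<forall>z\<in>Y. (x, z) \<in> parcs Gt \<longrightarrow> z = y"
proof -
  have first: "\<exists>i\<le>Suc t. path_vertex a b i \<in> Y \<and> (\<forall>j<i. path_vertex a b j \<notin> Y)"
    if "\<exists>i\<le>Suc t. path_vertex a b i \<in> Y" for a b
  proof -
    let ?i = "LEAST i. i \<le> Suc t \<and> path_vertex a b i \<in> Y"
    have "?i \<le> Suc t \<and> path_vertex a b ?i \<in> Y"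
      using that by (metis (mono_tags, lifting) LeastI_ex)
    moreover have "path_vertex a b j \<notin> Y" if "j < ?i" for j
      using not_less_Least[OF that] that calculation by simp
    ultimately show ?thesis by blast
  qed
  have inner: "\<exists>x\<in>Y. \<exists>y. \<forall>z\<in>Y. (x, z) \<in> parcs Gt \<longrightarrow> z = y"
    if "(a, b) \<in> parcs G" "1 \<le> i" "i \<le> t" "path_vertex a b i \<in> Y"
      "\<forall>j<i. path_vertex a b j \<notin> Y" for a b i
  proof -
    have "path_vertex a b (i - 1) \<notin> Y" using that by simp
    then have "\<forall>z\<in>Y. (path_vertex a b i, z) \<in> parcs Gt \<longrightarrow> z = path_vertex a b (Suc i)"
      using arc_from_inner that by metis
    then show ?thesis using that by blast
  qed
  have side: "\<exists>x\<in>Y. \<exists>y. \<forall>z\<in>Y. (x, z) \<in> parcs Gt \<longrightarrow> z = y"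
    if "(a, b) \<in> parcs G" "a \<notin> {u, v}" "x \<in> Y" "x \<in> inner_vertices t a b" for a b x
  proof -
    obtain k where k: "1 \<le> k" "k \<le> t" "x = path_vertex a b k"
      using \<open>x \<in> inner_vertices t a b\<close> by (rule inner_verticesE)
    then obtain i where i: "i \<le> Suc t" "path_vertex a b i \<in> Y" "\<forall>j<i. path_vertex a b j \<notin> Y"
      using first[of a b] \<open>x \<in> Y\<close> by (metis le_SucI)
    \<comment> \<open>\<open>Orig a\<close> is not in \<open>Y\<close>, and \<open>i \<le> k\<close>
      keeps the first vertex of \<open>Y\<close> before the far end \<open>b\<close>; so it is
      internal, with no predecessor in \<open>Y\<close>.\<close>
    have "i \<noteq> 0"
      using i Y that by (auto simp: inner_paths_def intro!: gr0I)
    moreover have "i \<le> k"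
      using i k \<open>x \<in> Y\<close> by (meson not_le)
    ultimately show ?thesis using inner[of a b i] i k that by simp
  qed
  show ?thesis
  proof (cases "\<exists>x\<in>Y. x \<in> \<Union>inner_paths \<and> x \<notin> inner_vertices t u v")
    case True
    then obtain x a b where x: "x \<in> Y" "(a, b) \<in> parcs G" "x \<in> inner_vertices t a b"
        "x \<notin> inner_vertices t u v"
      by (auto simp: inner_paths_def)
    then have "\<not> (a \<in> {u, v} \<and> b \<in> {u, v})"
      using arc_neq[OF x(2)] inner_vertices_swap[of u v] by auto
    then show ?thesis
      using side[of a b x] side[of b a x] x arc_sym inner_vertices_swap by auto
  next
    case False
    then have Y': "Y \<subseteq> inner_vertices t u v \<union> {Orig u, Orig v}"
      using Y by blast
    then have "\<exists>i\<le>Suc t. path_vertex u v i \<in> Y"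
    proof -
      obtain x where "x \<in> Y" using Y by blast
      moreover have "\<exists>i\<le>Suc t. x = path_vertex u v i"
        using Y' \<open>x \<in> Y\<close> by (auto elim!: inner_verticesE intro: le_SucI path_vertex_ends[symmetric])
      ultimately show ?thesis by blast
    qed
    then obtain i where i: "i \<le> Suc t" "path_vertex u v i \<in> Y" "\<forall>j<i. path_vertex u v j \<notin> Y"
      using first by blast
    \<comment> \<open>Here \<open>Y\<close> lies on the path of \<open>uv\<close>. If its first
      vertex is \<open>Orig u\<close>, arcs into other paths leave \<open>Y\<close>; if it is
      \<open>Orig v\<close>, then \<open>Y\<close> is a singleton.\<close>
    consider "i = 0" | "1 \<le> i" "i \<le> t" | "i = Suc t" using i by linarith
    then show ?thesis
    proof cases
      case 1
      have "z = path_vertex u v 1" if z: "z \<in> Y" "(Orig u, z) \<in> parcs Gt" for z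
      proof -
        obtain w where w: "(u, w) \<in> parcs G" "z = path_vertex u w 1"
          using z(2) by (rule arc_from_Orig)
        then have "z \<in> inner_vertices t u w"
          using t_ge_2 by (simp add: path_vertex_in_inner_vertices)
        moreover from this have "z \<in> inner_vertices t u v"
          using Y' z(1) by auto
        ultimately show ?thesis
          using inner_vertices_Int[OF uv w(1)] w by auto
      qed
      then show ?thesis using i 1 by auto
    next
      case 2
      then show ?thesis using inner uv i by blast
    next
      case 3
      have "z = Orig v" if "z \<in> Y" for z
      proof -
        have "z \<notin> inner_vertices t u v"
          using 3 i that by (auto elim!: inner_verticesE)
        moreover have "z \<noteq> Orig u" using 3 i that by (metis path_vertex_ends(1) zero_less_Suc)
        ultimately show ?thesis using Y' that by blast
      qed
      then show ?thesis using Y by blast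
    qed
  qed
qed

section \<open>Counting tokens\<close>

text \<open>Tokens never occupy consecutive positions, so each of the pairs \<open>{1, 2}\<close>,
  ..., \<open>{t - 1, t}\<close> holds at most one. With tokens on both ends, positions
  \<open>1\<close> and \<open>t\<close> are empty, and the \<open>t div 2 - 1\<close> shifted pairs
  \<open>{2, 3}\<close>, ..., \<open>{t - 2, t - 1}\<close> cover the rest.\<close>

lemma card_inner_le:
  assumes S: "independent_set Gt S" and uv: "(u, v) \<in> parcs G"
  shows "card (S \<inter> inner_vertices t u v) \<le> t div 2"
    and "Orig u \<in> S \<Longrightarrow> Orig v \<in> S \<Longrightarrow> card (S \<inter> inner_vertices t u v) < t div 2"
proof -
  define Q where "Q = {i \<in> {1..t}. path_vertex u v i \<in> S}"
  have fin: "finite Q" by (simp add: Q_def)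
  have "S \<inter> inner_vertices t u v = path_vertex u v ` Q"
    by (auto simp: Q_def path_vertex_in_inner_vertices elim!: inner_verticesE)
  then have le: "card (S \<inter> inner_vertices t u v) \<le> card Q"
    using card_image_le[OF fin] by simp
  have ne: "path_vertex u v (Suc i) \<notin> S" if "i \<le> t" "path_vertex u v i \<in> S" for i
    using S path_vertex_arc[OF uv that(1)] that by (auto simp: independent_set_def)
  have inj: "i = j" if "i \<in> Q" "j \<in> Q" "i \<le> Suc j" "j \<le> Suc i" for i j
  proof (rule ccontr)
    assume "i \<noteq> j"
    then have "i = Suc j \<or> j = Suc i" using that by auto
    then show False using that ne by (auto simp: Q_def)
  qed
  have "card Q \<le> card {..<t div 2}"
  proof (rule card_inj_on_le)
    show "inj_on (\<lambda>i. (i - 1) div 2) Q"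
      by (rule inj_onI, rule inj) (auto simp: Q_def)
    show "(\<lambda>i. (i - 1) div 2) ` Q \<subseteq> {..<t div 2}"
      using even_t by (auto simp: Q_def elim!: evenE)
  qed simp
  then show "card (S \<inter> inner_vertices t u v) \<le> t div 2"
    using le by simp
  assume ends: "Orig u \<in> S" "Orig v \<in> S"
  have "1 \<notin> Q" "t \<notin> Q"
    using ends ne[of 0] ne[of t] by (auto simp: Q_def)
  then have Q: "2 \<le> i \<and> i < t" if "i \<in> Q" for i
  proof -
    have "i \<noteq> 1" "i \<noteq> t" "1 \<le> i" "i \<le> t"
      using that \<open>1 \<notin> Q\<close> \<open>t \<notin> Q\<close> by (auto simp: Q_def)
    then show ?thesis by linarith
  qed
  have "card Q \<le> card {1..<t div 2}"
  proof (rule card_inj_on_le)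
    show "inj_on (\<lambda>i. i div 2) Q"
      by (rule inj_onI, rule inj) auto
    show "(\<lambda>i. i div 2) ` Q \<subseteq> {1..<t div 2}"
    proof clarify
      fix i assume "i \<in> Q"
      then show "i div 2 \<in> {1..<t div 2}"
        using Q[of i] even_t by (auto elim!: evenE)
    qed
  qed simp
  then show "card (S \<inter> inner_vertices t u v) < t div 2"
    using le t_ge_2 by auto
qed

lemma card_eq_sum_paths:
  assumes "S \<subseteq> pverts Gt"
  shows "card S = card {u. Orig u \<in> S} + (\<Sum>X\<in>inner_paths. card (S \<inter> X))"
proof -
  have fin: "finite S" using assms Gt.pair_finite_verts by (rule finite_subset)
  have "S = Orig ` {u. Orig u \<in> S} \<union> (\<Union>X\<in>inner_paths. S \<inter> X)"
    using assms by (auto simp: pverts_Gt)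
  moreover have "Orig ` {u. Orig u \<in> S} \<inter> (\<Union>X\<in>inner_paths. S \<inter> X) = {}"
    by (auto simp: inner_paths_def)
  moreover have "finite (Orig ` {u. Orig u \<in> S})"
    by (rule finite_subset[OF _ fin]) auto
  moreover have "finite (\<Union>X\<in>inner_paths. S \<inter> X)"
    using fin by auto
  ultimately have "card S = card (Orig ` {u. Orig u \<in> S}) + card (\<Union>X\<in>inner_paths. S \<inter> X)"
    by (metis card_Un_disjoint)
  moreover have "card (Orig ` {u. Orig u \<in> S}) = card {u. Orig u \<in> S}"
    by (simp add: card_image inj_on_def)
  moreover have "card (\<Union>X\<in>inner_paths. S \<inter> X) = (\<Sum>X\<in>inner_paths. card (S \<inter> X))"
  proof (rule card_UN_disjoint)
    have "X = X'" if X: "X \<in> inner_paths" "X' \<in> inner_paths" "x \<in> X" "x \<in> X'" for X X' x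
    proof -
      obtain a b c d where "(a, b) \<in> parcs G" "(c, d) \<in> parcs G"
          "X = inner_vertices t a b" "X' = inner_vertices t c d"
        using X by (auto simp: inner_paths_def)
      then show ?thesis
        using inner_vertices_Int[of a b c d x] X inner_vertices_swap by auto
    qed
    then show "\<forall>X\<in>inner_paths. \<forall>X'\<in>inner_paths. X \<noteq> X' \<longrightarrow> (S \<inter> X) \<inter> (S \<inter> X') = {}"
      by blast
  qed (use fin in auto)
  ultimately show ?thesis by simp
qed

section \<open>Deficient edges and the upper bound on independent sets of \<open>Gt\<close>\<close>

definition deficient :: "'a svertex set \<Rightarrow> 'a svertex set set" where
  "deficient S = {X \<in> inner_paths. card (S \<inter> X) < t div 2}"

lemma finite_deficient [simp]: "finite (deficient S)"
  by (simp add: deficient_def)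

text \<open>A deficient edge falls short of its \<open>t div 2\<close> inner tokens by at least
  one.\<close>

lemma card_add_deficient_le:
  assumes "independent_set Gt S"
  shows "card S + card (deficient S) \<le> card {u. Orig u \<in> S} + t div 2 * card inner_paths"
proof -
  have "card (deficient S) = (\<Sum>X\<in>inner_paths. if card (S \<inter> X) < t div 2 then 1 else 0)"
    by (simp add: deficient_def sum.If_cases Int_def)
  then have "(\<Sum>X\<in>inner_paths. card (S \<inter> X)) + card (deficient S) =
      (\<Sum>X\<in>inner_paths. card (S \<inter> X) + (if card (S \<inter> X) < t div 2 then 1 else 0))"
    by (simp add: sum.distrib)
  also have "\<dots> \<le> (\<Sum>X\<in>inner_paths. t div 2)"
    by (rule sum_mono) (use card_inner_le(1)[OF assms] in \<open>fastforce simp: inner_paths_def\<close>)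
  finally show ?thesis
    using card_eq_sum_paths[of S] assms by (simp add: independent_set_def mult.commute)
qed

lemma edge_within_deficient:
  assumes "independent_set Gt S" "(u, v) \<in> parcs G" "Orig u \<in> S" "Orig v \<in> S"
  shows "inner_vertices t u v \<in> deficient S"
  using card_inner_le(2)[OF assms] assms by (auto simp: deficient_def inner_paths_def)

text \<open>Each \<open>b\<close> outside \<open>A\<close> picks an edge of \<open>D\<close> whose
  other end is in \<open>A\<close>; such an edge has only one end outside \<open>A\<close>, so the
  choice is injective. The set \<open>D\<close> is left open so that one deficient edge can later be
  removed.\<close>

lemma card_Orig_le:
  assumes A: "Orig ` A \<subseteq> S" and S: "independent_set Gt S" and "finite D"
    and dom: "\<And>b. Orig b \<in> S \<Longrightarrow> b \<notin> A \<Longrightarrow> \<exists>a\<in>A. (b, a) \<in> parcs G \<and> inner_vertices t b a \<in> D"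
  shows "card {u. Orig u \<in> S} \<le> card A + card D"
proof -
  let ?W = "{u. Orig u \<in> S}"
  have finW: "finite ?W"
    using finite_vimageI[OF Gt.finite_independent_set[OF S], of Orig]
    by (simp add: vimage_def inj_on_def)
  have "\<forall>b\<in>?W - A. \<exists>a. a \<in> A \<and> (b, a) \<in> parcs G \<and> inner_vertices t b a \<in> D"
    using dom by blast
  then obtain g where g: "\<forall>b\<in>?W - A. g b \<in> A \<and> (b, g b) \<in> parcs G \<and> inner_vertices t b (g b) \<in> D"
    by (rule bchoice[THEN exE])
  have "inj_on (\<lambda>b. inner_vertices t b (g b)) (?W - A)"
  proof (rule inj_onI)
    fix b c assume "b \<in> ?W - A" "c \<in> ?W - A" "inner_vertices t b (g b) = inner_vertices t c (g c)"
    then show "b = c" using inner_vertices_eqD[of b "g b" c "g c"] g by blast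
  qed
  then have "card (?W - A) \<le> card D"
    using g by (intro card_inj_on_le[OF _ _ \<open>finite D\<close>]) auto
  moreover have "A \<subseteq> ?W" using A by auto
  ultimately show ?thesis
    using finW card_Diff_subset[of A ?W] card_mono[of ?W A] finite_subset[of A ?W] by simp
qed

text \<open>The tokens on original vertices need not be independent in \<open>G\<close>, but each
  one beyond an inclusion-maximal independent part \<open>B\<close> is paid for by a deficient
  edge.\<close>

lemma card_independent_Gt_le:
  assumes max: "maximum_independent_set G A" and S: "independent_set Gt S"
  shows "card S \<le> card A + t div 2 * card inner_paths"
proof -
  let ?W = "{u. Orig u \<in> S}"
  have W: "?W \<subseteq> pverts G" using S by (auto simp: independent_set_def)
  define F where "F = {B. B \<subseteq> ?W \<and> independent_set G B}"
  have "finite F"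
    by (rule finite_subset[of _ "Pow (pverts G)"]) (use W in \<open>auto simp: F_def\<close>)
  moreover have "{} \<in> F" by (simp add: F_def independent_set_def)
  ultimately obtain B where BF: "B \<in> F" and B_max: "\<And>C. C \<in> F \<Longrightarrow> B \<subseteq> C \<Longrightarrow> B = C"
    using finite_has_maximal[of F] by blast
  then have B: "B \<subseteq> ?W" "independent_set G B" by (simp_all add: F_def)
  have "\<exists>a\<in>B. (b, a) \<in> parcs G \<and> inner_vertices t b a \<in> deficient S"
    if b: "Orig b \<in> S" "b \<notin> B" for b
  proof -
    have "insert b B \<notin> F" using B_max[of "insert b B"] b by blast
    then have "\<not> independent_set G (insert b B)" using B b by (simp add: F_def)
    then obtain a where "a \<in> B" "(b, a) \<in> parcs G"
      using independent_set_insert[of B b] B W b by blast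
    then show ?thesis using edge_within_deficient[OF S] b B by blast
  qed
  then have "card ?W \<le> card B + card (deficient S)"
    using B S by (intro card_Orig_le) auto
  moreover have "card B \<le> card A"
    using max B by (auto simp: maximum_independent_set_def)
  ultimately show ?thesis using card_add_deficient_le[OF S] by simp
qed

lemma extension_Orig_iff:
  assumes "extension t G A S" "A \<subseteq> pverts G"
  shows "Orig u \<in> S \<longleftrightarrow> u \<in> A"
proof -
  have "S \<subseteq> pverts Gt" "S \<inter> Orig ` pverts G = Orig ` A"
    using assms by (auto simp: extension_def independent_set_def)
  then have "Orig u \<in> S \<longleftrightarrow> Orig u \<in> Orig ` A" by force
  then show ?thesis by auto
qed

lemma card_extension:
  assumes ext: "extension t G A S" and A: "independent_set G A"
  shows "card S = card A + t div 2 * card inner_paths"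
proof -
  have "{u. Orig u \<in> S} = A"
    using extension_Orig_iff[OF ext] A by (simp add: independent_set_def)
  moreover have "(\<Sum>X\<in>inner_paths. card (S \<inter> X)) = (\<Sum>X\<in>inner_paths. t div 2)"
    using ext by (intro sum.cong) (auto simp: extension_def inner_paths_def)
  ultimately show ?thesis
    using card_eq_sum_paths[of S] ext by (simp add: extension_def independent_set_def mult.commute)
qed

text \<open>An extension attains the bound of \<open>card_independent_Gt_le\<close>.\<close>

lemma maximum_extension:
  assumes "maximum_independent_set G A" "extension t G A S"
  shows "maximum_independent_set Gt S"
  using assms card_independent_Gt_le[OF assms(1)] card_extension[OF assms(2)]
  by (simp add: maximum_independent_set_def extension_def)

section \<open>From the subdivision to the graph\<close>

text \<open>If \<open>v\<close> carried no token or had another neighbour in \<open>A\<close>, then the vertices of \<open>S\<close> outside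
  \<open>A\<close> could be matched to deficient edges other than \<open>uv\<close>, and \<open>S\<close> would be too small.\<close>

lemma deficient_edge:
  assumes max: "maximum_independent_set G A" and S: "independent_set Gt S"
    and card: "card S = card A + t div 2 * card inner_paths" and A: "Orig ` A \<subseteq> S"
    and uv: "(u, v) \<in> parcs G" "u \<in> A" and def: "inner_vertices t u v \<in> deficient S"
  shows "Orig v \<in> S \<and> (\<forall>w\<in>A. (v, w) \<in> parcs G \<longrightarrow> w = u)"
proof (rule ccontr)
  assume neg: "\<not> ?thesis"
  have "\<exists>a\<in>A. (b, a) \<in> parcs G \<and> inner_vertices t b a \<in> deficient S - {inner_vertices t u v}"
    if b: "Orig b \<in> S" "b \<notin> A" for b
  proof -
    have "b \<in> pverts G" using S b by (auto simp: independent_set_def)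
    then obtain a where "a \<in> A" "(b, a) \<in> parcs G"
      using maximum_independent_set_dominates[OF max] b by blast
    \<comment> \<open>For \<open>b = v\<close> the token on \<open>Orig v\<close> is present, so the
      negated claim supplies a neighbour of \<open>v\<close> in \<open>A\<close> other than
      \<open>u\<close>. Thus the edge \<open>uv\<close> is never picked.\<close>
    then obtain a where a: "a \<in> A" "(b, a) \<in> parcs G" "b = v \<longrightarrow> a \<noteq> u"
      using neg b by blast
    then have "inner_vertices t b a \<noteq> inner_vertices t u v"
      using inner_vertices_eqD[of b a u v] uv b by blast
    then show ?thesis using a edge_within_deficient[OF S] b A by blast
  qed
  then have "card {u. Orig u \<in> S} \<le> card A + card (deficient S - {inner_vertices t u v})"
    using card_Orig_le[OF A S] by simp
  moreover have "card (deficient S - {inner_vertices t u v}) < card (deficient S)"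
    using def by (intro card_Diff1_less) auto
  ultimately show False using card_add_deficient_le[OF S] card by simp
qed

text \<open>\<open>A\<close> stays put unless the token that leaves sits on one of its vertices; the
  closure in the conclusion covers both cases.\<close>

lemma project_step:
  assumes max: "maximum_independent_set G A" and step: "reconf_step TS Gt S T"
    and card: "card S = card A + t div 2 * card inner_paths" and A: "Orig ` A \<subseteq> S"
  shows "\<exists>B. maximum_independent_set G B \<and> Orig ` B \<subseteq> T \<and> (reconf_step TS G)\<^sup>*\<^sup>* A B"
proof (cases "Orig ` A \<subseteq> T")
  case True
  then show ?thesis using max by blast
next
  case False
  have S: "independent_set Gt S" and T: "independent_set Gt T"
    using step by (auto simp: reconf_step_def)
  obtain x y where xy: "S - T = {x}" "T - S = {y}" "(x, y) \<in> parcs Gt"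
    using step by (auto simp: reconf_step_def)
  then have T_eq: "T = insert y (S - {x})" and yS: "y \<notin> S" by blast+
  obtain u where "u \<in> A" "Orig u \<notin> T" using False by auto
  then have "Orig u \<in> S - T" using A by auto
  then have u: "u \<in> A" "x = Orig u" using xy(1) \<open>u \<in> A\<close> by simp_all
  obtain v where v: "(u, v) \<in> parcs G" "y = path_vertex u v 1"
    using xy(3) unfolding u(2) by (rule arc_from_Orig)
  have y: "y \<in> inner_vertices t u v"
    using v t_ge_2 by (simp add: path_vertex_in_inner_vertices)
  \<comment> \<open>The token moves from \<open>Orig u\<close> onto this path, so \<open>T\<close>
    has one inner token more there than \<open>S\<close>; as \<open>T\<close> has at most
    \<open>t div 2\<close>, the edge was deficient in \<open>S\<close>.\<close>
  have "T \<inter> inner_vertices t u v = insert y (S \<inter> inner_vertices t u v)"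
    using T_eq y u by auto
  then have "card (S \<inter> inner_vertices t u v) < card (T \<inter> inner_vertices t u v)"
    using yS by simp
  then have "inner_vertices t u v \<in> deficient S"
    using card_inner_le(1)[OF T v(1)] v(1) by (auto simp: deficient_def inner_paths_def)
  then have *: "Orig v \<in> S" "\<And>w. w \<in> A \<Longrightarrow> (v, w) \<in> parcs G \<Longrightarrow> w = u"
    using deficient_edge[OF max S card A v(1) u(1)] by blast+
  have vA: "v \<notin> A"
    using v u maximum_independent_setD[OF max] by (auto simp: independent_set_def)
  let ?B = "insert v (A - {u})"
  have "independent_set G (A - {u})"
    using maximum_independent_setD[OF max] by (auto simp: independent_set_def)
  then have "independent_set G ?B"
    by (rule independent_set_insert) (use * v in_arcsD2 in auto)
  moreover have "A - ?B = {u}" "?B - A = {v}" using vA u v arc_neq by auto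
  ultimately have "reconf_step TS G A ?B"
    using maximum_independent_setD[OF max] v by (simp add: reconf_step_def)
  moreover have "Orig ` ?B \<subseteq> T" using A *(1) T_eq u arc_neq[OF v(1)] by auto
  ultimately show ?thesis using reconf_step_maximum[OF max] by blast
qed

lemma project_steps:
  assumes max: "maximum_independent_set G I" "maximum_independent_set G J"
    and ext: "extension t G I I'" "extension t G J J'"
    and steps: "(reconf_step TS Gt)\<^sup>*\<^sup>* I' J'"
  shows "(reconf_step TS G)\<^sup>*\<^sup>* I J"
proof -
  have card_eq: "card A = card I" if "maximum_independent_set G A" for A
    using that max(1) by (auto simp: maximum_independent_set_def intro: order_antisym)
  \<comment> \<open>The size of the current set is part of the invariant because
    \<open>project_step\<close> needs equality in the counting bound.\<close>
  have "\<exists>A. maximum_independent_set G A \<and> Orig ` A \<subseteq> J' \<and> (reconf_step TS G)\<^sup>*\<^sup>* I A \<and>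
      card J' = card I + t div 2 * card inner_paths"
    using steps
  proof (induction rule: rtranclp_induct)
    case base
    have "Orig ` I \<subseteq> I'" using ext by (auto simp: extension_def)
    then show ?case
      using max card_extension[OF ext(1)] by (auto simp: maximum_independent_set_def)
  next
    case (step S T)
    then obtain A where A: "maximum_independent_set G A" "Orig ` A \<subseteq> S"
        "(reconf_step TS G)\<^sup>*\<^sup>* I A" "card S = card A + t div 2 * card inner_paths"
      using card_eq by auto
    then obtain B where "maximum_independent_set G B" "Orig ` B \<subseteq> T" "(reconf_step TS G)\<^sup>*\<^sup>* A B"
      using project_step step.hyps by blast
    then show ?case
      using A step.IH Gt.reconf_step_card_eq[OF step.hyps(2)] by (metis rtranclp_trans)
  qed
  then obtain A where A: "maximum_independent_set G A" "Orig ` A \<subseteq> J'" "(reconf_step TS G)\<^sup>*\<^sup>* I A"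
    by blast
  \<comment> \<open>\<open>J'\<close> meets the original vertices exactly in \<open>J\<close>; both
    \<open>A\<close> and \<open>J\<close> are maximum, so inclusion becomes equality.\<close>
  have "A \<subseteq> J"
    using extension_Orig_iff[OF ext(2)] A max(2)
    by (auto simp: maximum_independent_set_def independent_set_def)
  then have "A = J"
    using card_eq[OF A(1)] card_eq[OF max(2)] finite_independent_set
      maximum_independent_setD[OF max(2)]
    by (metis card_subset_eq)
  then show ?thesis using A by simp
qed

section \<open>From the graph to the subdivision\<close>

text \<open>Each edge has an end \<open>v\<close> outside \<open>A\<close>. Walking towards
  \<open>v\<close>, tokens go on positions 2, 4, ..., \<open>t\<close>: position 1 stays empty next
  to \<open>u\<close>, and the last token is next to the empty \<open>v\<close>. The edges are
  filled independently of one another.\<close>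

lemma ex_extension:
  assumes A: "independent_set G A"
  shows "\<exists>S. extension t G A S"
proof -
  have "\<exists>C\<subseteq>X. card C = t div 2 \<and> independent_set Gt (C \<union> Orig ` A)" if X: "X \<in> inner_paths" for X
  proof -
    obtain a b where "(a, b) \<in> parcs G" "X = inner_vertices t a b"
      using X by (auto simp: inner_paths_def)
    moreover from this have "a \<notin> A \<or> b \<notin> A"
      using A by (auto simp: independent_set_def)
    ultimately obtain u v where uv: "(u, v) \<in> parcs G" "X = inner_vertices t u v" "v \<notin> A"
      using arc_sym inner_vertices_swap by metis
    define C where "C = (\<lambda>j. path_vertex u v (2 * j)) ` {1..t div 2}"
    have CX: "C \<subseteq> X"
      using uv by (auto simp: C_def intro!: path_vertex_in_inner_vertices)
    have "inj_on (\<lambda>j. path_vertex u v (2 * j)) {1..t div 2}"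
    proof (rule inj_onI)
      fix i j assume ij: "i \<in> {1..t div 2}" "j \<in> {1..t div 2}"
        "path_vertex u v (2 * i) = path_vertex u v (2 * j)"
      then show "i = j"
        using path_vertex_inj[OF uv(1), of "2 * i" "2 * j"] by auto
    qed
    then have "card C = t div 2" by (simp add: C_def card_image)
    \<comment> \<open>As \<open>t\<close> is even, the odd positions include \<open>Suc t\<close>,
      which is \<open>v\<close> itself; hence every neighbour of a token in \<open>C\<close> is
      free.\<close>
    have odd: "path_vertex u v i \<notin> C \<union> Orig ` A" if "odd i" "i \<le> Suc t" for i
    proof (cases "i = Suc t")
      case True
      then show ?thesis using uv CX by auto
    next
      case False
      then have i: "1 \<le> i" "i \<le> t" using that by (auto elim: oddE)
      have "path_vertex u v i \<notin> C"
      proof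
        assume "path_vertex u v i \<in> C"
        then obtain j where j: "1 \<le> j" "j \<le> t div 2" "path_vertex u v i = path_vertex u v (2 * j)"
          by (auto simp: C_def)
        then have "i = 2 * j"
          using path_vertex_inj[OF uv(1) i, of "2 * j"] by auto
        then show False using that by simp
      qed
      moreover have "path_vertex u v i \<notin> Orig ` A"
        using path_vertex_in_inner_vertices[OF i, of u v] by auto
      ultimately show ?thesis by simp
    qed
    have noarc: "(x, y) \<notin> parcs Gt" if "x \<in> C" "y \<in> C \<union> Orig ` A" for x y
    proof
      assume arc: "(x, y) \<in> parcs Gt"
      obtain j where j: "1 \<le> j" "2 * j \<le> t" "x = path_vertex u v (2 * j)"
        using \<open>x \<in> C\<close> by (auto simp: C_def)
      then have "y = path_vertex u v (2 * j - 1) \<or> y = path_vertex u v (Suc (2 * j))"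
        using arc_from_inner[OF uv(1), of "2 * j" y] arc by simp
      then show False
        using odd[of "2 * j - 1"] odd[of "Suc (2 * j)"] j(1,2) that(2) by (elim disjE) simp_all
    qed
    have "C \<union> Orig ` A \<subseteq> pverts Gt"
      using CX X A by (auto simp: pverts_Gt independent_set_def)
    then have "independent_set Gt (C \<union> Orig ` A)"
      using noarc arc_Orig_Orig Gt.arc_sym unfolding independent_set_def by blast
    then show ?thesis using CX \<open>card C = t div 2\<close> by blast
  qed
  then have "\<forall>X\<in>inner_paths. \<exists>C. C \<subseteq> X \<and> card C = t div 2 \<and> independent_set Gt (C \<union> Orig ` A)"
    by blast
  then obtain C where C: "\<forall>X\<in>inner_paths. C X \<subseteq> X \<and> card (C X) = t div 2 \<and>
      independent_set Gt (C X \<union> Orig ` A)"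
    by (rule bchoice[THEN exE])
  let ?S = "Orig ` A \<union> (\<Union>X\<in>inner_paths. C X)"
  have Int: "?S \<inter> inner_vertices t u v = C (inner_vertices t u v)" if uv: "(u, v) \<in> parcs G" for u v
  proof -
    have X: "inner_vertices t u v \<in> inner_paths" using uv by (auto simp: inner_paths_def)
    have "x \<in> C (inner_vertices t u v)"
      if x: "x \<in> C X'" "X' \<in> inner_paths" "x \<in> inner_vertices t u v" for x X'
    proof -
      obtain a b where ab: "(a, b) \<in> parcs G" "X' = inner_vertices t a b"
        using x by (auto simp: inner_paths_def)
      then have "x \<in> inner_vertices t a b" using C x by blast
      then have "X' = inner_vertices t u v"
        using inner_vertices_Int[OF uv ab(1) x(3)] ab inner_vertices_swap by auto
      then show ?thesis using x by simp
    qed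
    then show ?thesis using C X by auto
  qed
  have "(x, y) \<notin> parcs Gt" if xy: "x \<in> ?S" "y \<in> ?S" for x y
  proof
    assume "(x, y) \<in> parcs Gt"
    then obtain u v i where i: "(u, v) \<in> parcs G" "i \<le> t" "x = path_vertex u v i"
        "y = path_vertex u v (Suc i)"
      by (rule arc_Gt_cases)
    \<comment> \<open>An arc of \<open>Gt\<close> lies on a single path, so independence of the
      whole set reduces to that of the choice for this one edge.\<close>
    have mem: "z \<in> C (inner_vertices t u v) \<union> Orig ` A"
      if "z \<in> ?S" "z = path_vertex u v j" "j \<le> Suc t" for z j
    proof (cases "j = 0 \<or> j = Suc t")
      case True
      then have "z \<in> range Orig" using that by auto
      moreover have "z \<notin> (\<Union>X\<in>inner_paths. C X)"
        using calculation C by (force simp: inner_paths_def)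
      ultimately show ?thesis using that(1) by blast
    next
      case False
      then have "z \<in> inner_vertices t u v" using that by (simp add: path_vertex_in_inner_vertices)
      then show ?thesis using that(1) Int[OF i(1)] by blast
    qed
    have "x \<in> C (inner_vertices t u v) \<union> Orig ` A" "y \<in> C (inner_vertices t u v) \<union> Orig ` A"
      using mem[OF xy(1) i(3)] mem[OF xy(2) i(4)] i(2) by auto
    moreover have "independent_set Gt (C (inner_vertices t u v) \<union> Orig ` A)"
      using C i(1) by (auto simp: inner_paths_def)
    ultimately show False
      using \<open>(x, y) \<in> parcs Gt\<close> by (auto simp: independent_set_def)
  qed
  moreover have "?S \<subseteq> pverts Gt"
    using A C by (auto simp: pverts_Gt independent_set_def)
  ultimately have "independent_set Gt ?S" by (auto simp: independent_set_def)
  moreover have "?S \<inter> Orig ` pverts G = Orig ` A"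
  proof -
    have "Orig w \<notin> C X" if "X \<in> inner_paths" for w X
      using C that by (force simp: inner_paths_def)
    then show ?thesis using A by (auto simp: independent_set_def)
  qed
  moreover have "card (?S \<inter> inner_vertices t u v) = t div 2" if "(u, v) \<in> parcs G" for u v
    using Int[OF that] C that by (auto simp: inner_paths_def)
  ultimately have "extension t G A ?S" by (auto simp: extension_def)
  then show ?thesis ..
qed

section \<open>Lifting slides to extensions\<close>

lemma extensions_symdiff:
  assumes "extension t G A S" "extension t G B T" "A \<subseteq> pverts G" "B \<subseteq> pverts G"
  shows "(S - T) \<union> (T - S) \<subseteq> \<Union>inner_paths \<union> Orig ` ((A - B) \<union> (B - A))"
proof
  fix x assume x: "x \<in> (S - T) \<union> (T - S)"
  then have "x \<in> pverts Gt" using assms by (auto simp: extension_def independent_set_def)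
  then show "x \<in> \<Union>inner_paths \<union> Orig ` ((A - B) \<union> (B - A))"
    using x extension_Orig_iff[OF assms(1,3)] extension_Orig_iff[OF assms(2,4)]
    by (auto simp: pverts_Gt)
qed

lemma extensions_reconf_steps:
  assumes max: "maximum_independent_set G A" "maximum_independent_set G B"
    and ext: "extension t G A S" "extension t G B T"
    and AB: "A = B \<or> reconf_step TS G A B"
  shows "(reconf_step TS Gt)\<^sup>*\<^sup>* S T"
proof (rule Gt.reconf_steps_if_forest)
  show "maximum_independent_set Gt S" "maximum_independent_set Gt T"
    using maximum_extension max ext by blast+
  fix Y assume Y: "Y \<subseteq> (S - T) \<union> (T - S)" "Y \<noteq> {}"
  have "A \<subseteq> pverts G" "B \<subseteq> pverts G"
    using max by (auto simp: maximum_independent_set_def independent_set_def)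
  then have Y': "Y \<subseteq> \<Union>inner_paths \<union> Orig ` ((A - B) \<union> (B - A))"
    using extensions_symdiff[OF ext] order_trans[OF Y(1)] by simp
  have "\<exists>u v. (u, v) \<in> parcs G \<and> Y \<subseteq> \<Union>inner_paths \<union> {Orig u, Orig v}"
    using AB
  proof
    assume "A = B"
    then have "Y \<subseteq> \<Union>inner_paths" using Y' by simp
    \<comment> \<open>Any edge will do here; one exists because \<open>Y\<close> is nonempty and
      consists of internal vertices.\<close>
    moreover from this have "inner_paths \<noteq> {}" using Y(2) by auto
    then obtain u v where "(u, v) \<in> parcs G"
      by (auto simp: inner_paths_def)
    ultimately show ?thesis by blast
  next
    assume "reconf_step TS G A B"
    then obtain u v where "A - B = {u}" "B - A = {v}" "(u, v) \<in> parcs G"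
      by (auto simp: reconf_step_def)
    moreover from this have "Orig ` ((A - B) \<union> (B - A)) = {Orig u, Orig v}"
      by (simp add: insert_commute)
    ultimately show ?thesis using Y' by (intro exI[of _ u] exI[of _ v] conjI) simp_all
  qed
  then show "\<exists>x\<in>Y. \<exists>y. \<forall>z\<in>Y. (x, z) \<in> parcs Gt \<longrightarrow> z = y"
    using leaf_of_inner_with_edge Y by blast
qed

lemma lift_steps:
  assumes max: "maximum_independent_set G I"
    and ext: "extension t G I I'" "extension t G J J'"
    and steps: "(reconf_step TS G)\<^sup>*\<^sup>* I J"
  shows "(reconf_step TS Gt)\<^sup>*\<^sup>* I' J'"
proof -
  have "maximum_independent_set G J \<and> (\<exists>S. extension t G J S \<and> (reconf_step TS Gt)\<^sup>*\<^sup>* I' S)"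
    using steps
  proof (induction rule: rtranclp_induct)
    case base
    then show ?case using max ext by blast
  next
    case (step A B)
    then obtain S where S: "extension t G A S" "(reconf_step TS Gt)\<^sup>*\<^sup>* I' S" by blast
    have B: "maximum_independent_set G B" using step reconf_step_maximum by blast
    then obtain T where T: "extension t G B T"
      using ex_extension maximum_independent_setD by blast
    then have "(reconf_step TS Gt)\<^sup>*\<^sup>* S T"
      using extensions_reconf_steps step B S by blast
    then show ?case using B T S by (meson rtranclp_trans)
  qed
  then obtain S where "maximum_independent_set G J" "extension t G J S" "(reconf_step TS Gt)\<^sup>*\<^sup>* I' S"
    by blast
  \<comment> \<open>The extension \<open>S\<close> of \<open>J\<close> that was reached may differ
    from \<open>J'\<close>; the case of equal sets in \<open>extensions_reconf_steps\<close> joins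
    the two.\<close>
  then show ?thesis
    using extensions_reconf_steps[of J J S J'] ext by (meson rtranclp_trans)
qed

end

theorem theorem3p2:
  fixes G :: "'a pair_pre_digraph"
    and t :: nat
    and I J :: "'a set"
    and I' J' :: "'a svertex set"
    and R :: rule
  assumes "pair_graph G"
    and "t \<ge> 2" and "even t"
    and "maximum_independent_set G I"
    and "maximum_independent_set G J"
    and "extension t G I I'"
    and "extension t G J J'"
  shows "(\<exists>Ss. reconf_sequence R G I J Ss) \<longleftrightarrow>
    (\<exists>Ss. reconf_sequence R (t_subdivision t G) I' J' Ss)"
proof -
  interpret even_subdivision G t
    by (intro even_subdivision.intro even_subdivision_axioms.intro assms)
  \<comment> \<open>Maximality of \<open>I'\<close> reduces \<open>R\<close> to slides in
    \<open>Gt\<close> as well.\<close>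
  have max: "maximum_independent_set Gt I'"
    using assms(4,6) by (rule maximum_extension)
  have "(\<exists>Ss. reconf_sequence R G I J Ss) \<longleftrightarrow> (reconf_step TS G)\<^sup>*\<^sup>* I J"
    using maximum_independent_setD[OF assms(4)] reconf_steps_sliding_iff[OF assms(4), of R J]
    by (simp add: ex_reconf_sequence_iff)
  also have "\<dots> \<longleftrightarrow> (reconf_step TS Gt)\<^sup>*\<^sup>* I' J'"
    using lift_steps[OF assms(4,6,7)] project_steps[OF assms(4-7)] by (rule iffI)
  also have "\<dots> \<longleftrightarrow> (\<exists>Ss. reconf_sequence R Gt I' J' Ss)"
    using maximum_independent_setD[OF max] Gt.reconf_steps_sliding_iff[OF max, of R J']
    by (simp add: ex_reconf_sequence_iff)
  finally show ?thesis .
qed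

end
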